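(* Let $\mathbf{K}$ be a full subcategory of $\mathbf{Top}_0$ containing $\mathbf{Sob}$. If $\mathbf{K}$ is adequate, then $\mathbf{K}$ is reflective in $\mathbf{Top}_0$.
   Context: $\mathbf{Top}_0$ is the category of all $T_0$ spaces with continuous maps. A nonempty subset $A$ of a space is irreducible if, whenever $A\subseteq F_1\cup F_2$ with $F_1,F_2$ closed, $A\subseteq F_1$ or $A\subseteq F_2$. A space $X$ is sober if every irreducible closed set is $\overline{\{a\}}$ for a unique point $a$. $\mathbf{Sob}$ is the full subcategory of sober spaces. Objects of $\mathbf{K}$ are called $\mathbf{K}$-spaces. A subset $A$ of a $T_0$ space $X$ is a $\mathbf{K}$-set if for every continuous map $f:X\to Y$ to a $\mathbf{K}$-space $Y$ there is a unique $y_A\in Y$ with $\overline{f(A)}=\overline{\{y_A\}}$. $\mathbf{K}(X)$ is the set of all closed $\mathbf{K}$-sets of $X$. $P_H(\mathbf{K}(X))$ is $\mathbf{K}(X)$ with the lower Vietoris topology, i.e. the topology having as a subbase the sets $\Diamond U=\{A\in\mathbf{K}(X): A\cap U\neq\emptyset\}$, $U$ open in $X$. $\mathbf{K}$ is called adequate if for every $T_0$ space $X$, $P_H(\mathbf{K}(X))$ is a $\mathbf{K}$-space. *)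

theory Defs
  imports "HOL-Analysis.Analysis"
begin

text \<open>
  A class of spaces \<open>K\<close> has to contain, together with \<open>X\<close>, spaces whose points are subsets
  of \<open>X\<close>, and \<open>K\<close>-sets are defined by quantifying over all members of \<open>K\<close>.  No single
  HOL type of points is closed under forming power sets, so, as in set theory, the sets in
  play are themselves elements of one universe \<open>'u\<close>: \<open>elts a\<close> is the extension of the set \<open>a\<close>.
  Only extensionality and closure under subsets and power sets are required; every
  Grothendieck universe and every type of ZFC sets with its membership relation qualifies.
\<close>

definition set_universe :: "('u \<Rightarrow> 'u set) \<Rightarrow> bool" where
  "set_universe elts \<longleftrightarrow>
     inj elts \<and>
     (\<forall>a B. B \<subseteq> elts a \<longrightarrow> (\<exists>b. elts b = B)) \<and>
     (\<forall>a. \<exists>p. elts p = {b. elts b \<subseteq> elts a})"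

definition irreducible_in :: "'a topology \<Rightarrow> 'a set \<Rightarrow> bool" where
  "irreducible_in X A \<longleftrightarrow>
     A \<subseteq> topspace X \<and> A \<noteq> {} \<and>
     (\<forall>F1 F2. closedin X F1 \<and> closedin X F2 \<and> A \<subseteq> F1 \<union> F2 \<longrightarrow> A \<subseteq> F1 \<or> A \<subseteq> F2)"

definition sober_space :: "'a topology \<Rightarrow> bool" where
  "sober_space X \<longleftrightarrow>
     (\<forall>A. closedin X A \<and> irreducible_in X A \<longrightarrow>
        (\<exists>!a. a \<in> topspace X \<and> A = X closure_of {a}))"

text \<open>
  A full subcategory of the category of \<open>T\<^sub>0\<close> spaces and continuous maps is given by its
  class of objects.
\<close>

definition Top0 :: "('u \<Rightarrow> 'u set) \<Rightarrow> 'u topology set" where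
  "Top0 elts = {X. (\<exists>a. elts a = topspace X) \<and> t0_space X}"

definition Sob :: "('u \<Rightarrow> 'u set) \<Rightarrow> 'u topology set" where
  "Sob elts = {X \<in> Top0 elts. sober_space X}"

definition K_set :: "'u topology set \<Rightarrow> 'u topology \<Rightarrow> 'u set \<Rightarrow> bool" where
  "K_set K X A \<longleftrightarrow>
     A \<subseteq> topspace X \<and>
     (\<forall>Y\<in>K. \<forall>f. continuous_map X Y f \<longrightarrow>
        (\<exists>!y. y \<in> topspace Y \<and> Y closure_of (f ` A) = Y closure_of {y}))"

text \<open>The set \<open>K(X)\<close>, its members being subsets of \<open>X\<close> regarded as elements of the universe.\<close>

definition closed_K_sets ::
    "('u \<Rightarrow> 'u set) \<Rightarrow> 'u topology set \<Rightarrow> 'u topology \<Rightarrow> 'u set" where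
  "closed_K_sets elts K X = {a. closedin X (elts a) \<and> K_set K X (elts a)}"

definition diamond ::
    "('u \<Rightarrow> 'u set) \<Rightarrow> 'u topology set \<Rightarrow> 'u topology \<Rightarrow> 'u set \<Rightarrow> 'u set" where
  "diamond elts K X U = {a \<in> closed_K_sets elts K X. elts a \<inter> U \<noteq> {}}"

text \<open>
  Relativising to \<open>K(X)\<close> makes the empty intersection the whole of \<open>K(X)\<close>, so that this is
  always the underlying set of the space.
\<close>

definition P_H :: "('u \<Rightarrow> 'u set) \<Rightarrow> 'u topology set \<Rightarrow> 'u topology \<Rightarrow> 'u topology" where
  "P_H elts K X =
     topology (arbitrary union_of
       (finite intersection_of (\<lambda>S. \<exists>U. openin X U \<and> S = diamond elts K X U)
          relative_to closed_K_sets elts K X))"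

definition adequate :: "('u \<Rightarrow> 'u set) \<Rightarrow> 'u topology set \<Rightarrow> bool" where
  "adequate elts K \<longleftrightarrow> (\<forall>X \<in> Top0 elts. P_H elts K X \<in> K)"

text \<open>
  Morphisms out of \<open>R\<close> are functions on \<open>topspace R\<close>; restricting the mediating map to
  \<open>extensional\<close> functions makes its uniqueness mean uniqueness on \<open>topspace R\<close>.
\<close>

definition is_reflection ::
    "'u topology set \<Rightarrow> 'u topology \<Rightarrow> 'u topology \<Rightarrow> ('u \<Rightarrow> 'u) \<Rightarrow> bool" where
  "is_reflection K X R \<eta> \<longleftrightarrow>
     R \<in> K \<and> continuous_map X R \<eta> \<and>
     (\<forall>Y\<in>K. \<forall>f. continuous_map X Y f \<longrightarrow>
        (\<exists>!g. g \<in> extensional (topspace R) \<and> continuous_map R Y g \<and>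
              (\<forall>x\<in>topspace X. g (\<eta> x) = f x)))"

definition reflective_in :: "'u topology set \<Rightarrow> 'u topology set \<Rightarrow> bool" where
  "reflective_in K C \<longleftrightarrow> K \<subseteq> C \<and> (\<forall>X\<in>C. \<exists>R \<eta>. is_reflection K X R \<eta>)"

end

theory Submission
  imports Defs
begin

text \<open>
  The reflection of \<open>X\<close> is \<open>P\<^sub>H(K(X))\<close> with \<open>\<eta> x\<close> the closure of \<open>{x}\<close>, and a map \<open>f : X \<rightarrow> Y\<close>
  extends by sending a closed \<open>K\<close>-set \<open>A\<close> to the point \<open>y\<^sub>A\<close> whose closure is that of \<open>f(A)\<close>.
  Since \<open>K\<close> contains the finite \<open>T\<^sub>0\<close> spaces, \<open>K\<close>-sets are irreducible.  Hence the sets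
  \<open>\<diamond>U\<close> are closed under finite intersections and already form a topology, in which \<open>{A}\<close> and
  \<open>\<eta>(A)\<close> have the same closure; this forces any extension of \<open>f\<close> to take the value \<open>y\<^sub>A\<close> at \<open>A\<close>.
\<close>

section \<open>Irreducible sets and finite T0 spaces\<close>

lemma irreducible_in_subset_Union:
  assumes "irreducible_in X A" "finite \<F>" "\<And>F. F \<in> \<F> \<Longrightarrow> closedin X F" "A \<subseteq> \<Union>\<F>"
  shows "\<exists>F\<in>\<F>. A \<subseteq> F"
  using assms(2-4)
proof (induction \<F>)
  case empty
  then show ?case using assms(1) by (auto simp: irreducible_in_def)
next
  case (insert F \<F>)
  have "closedin X F" "closedin X (\<Union>\<F>)" "A \<subseteq> F \<union> \<Union>\<F>"
    using insert by (auto intro!: closedin_Union)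
  then have "A \<subseteq> F \<or> A \<subseteq> \<Union>\<F>"
    using assms(1) unfolding irreducible_in_def by blast
  then show ?case using insert by auto
qed

text \<open>Otherwise the complements of \<open>U\<close> and \<open>V\<close> would be two closed
  sets covering \<open>A\<close>, neither containing it. This is what makes the sets
  \<open>diamond elts K X U\<close> closed under binary intersection.\<close>

lemma irreducible_in_meets_Int:
  assumes A: "irreducible_in X A" and U: "openin X U" and V: "openin X V"
    and "A \<inter> U \<noteq> {}" "A \<inter> V \<noteq> {}"
  shows "A \<inter> (U \<inter> V) \<noteq> {}"
proof
  assume "A \<inter> (U \<inter> V) = {}"
  moreover have "A \<subseteq> topspace X"
    using A by (simp add: irreducible_in_def)
  ultimately have "A \<subseteq> (topspace X - U) \<union> (topspace X - V)"
    by blast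
  moreover have "closedin X (topspace X - U)" "closedin X (topspace X - V)"
    using U V by auto
  ultimately have "A \<subseteq> topspace X - U \<or> A \<subseteq> topspace X - V"
    using A unfolding irreducible_in_def by blast
  then show False using assms(4,5) by blast
qed

lemma t0_space_closure_of_sing_inject:
  assumes "t0_space X" "x \<in> topspace X" "y \<in> topspace X" "X closure_of {x} = X closure_of {y}"
  shows "x = y"
  using assms by (simp add: t0_space_closure_of_sing)

text \<open>A finite closed set is the finite union of the closures of its points, so if it is
  irreducible, one of these closures is all of it. Uniqueness of the point is the T0 axiom.\<close>

lemma sober_space_finite_t0:
  assumes fin: "finite (topspace X)" and t0: "t0_space X"
  shows "sober_space X"
  unfolding sober_space_def
proof (intro allI impI)
  fix A assume A: "closedin X A \<and> irreducible_in X A"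
  then have sub: "A \<subseteq> topspace X" by (simp add: closedin_subset)
  have "A \<subseteq> \<Union>((\<lambda>a. X closure_of {a}) ` A)"
    using sub by (force simp: in_closure_of)
  moreover have "finite ((\<lambda>a. X closure_of {a}) ` A)"
    using sub fin finite_subset by blast
  ultimately have "\<exists>F\<in>(\<lambda>a. X closure_of {a}) ` A. A \<subseteq> F"
    using A by (intro irreducible_in_subset_Union[of X]) auto
  then obtain a where "a \<in> A" "A \<subseteq> X closure_of {a}"
    by blast
  moreover have "X closure_of {a} \<subseteq> A" if "a \<in> A"
    using A that by (simp add: closure_of_minimal)
  ultimately have "a \<in> topspace X \<and> A = X closure_of {a}"
    using sub by blast
  then show "\<exists>!a. a \<in> topspace X \<and> A = X closure_of {a}"
    using t0_space_closure_of_sing_inject[OF t0] by metis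
qed

text \<open>
  The quotient of \<open>X\<close> that only remembers membership in \<open>F1\<close> and in \<open>F2\<close> has at most four
  points.  It is carried by representatives chosen in \<open>X\<close>, so that it stays in the universe.
\<close>

lemma finite_t0_quotient:
  fixes X :: "'a topology"
  assumes F1: "closedin X F1" and F2: "closedin X F2"
  obtains Y r where "topspace Y \<subseteq> topspace X" "finite (topspace Y)" "t0_space Y"
    "continuous_map X Y r" "closedin Y (topspace Y \<inter> F1)" "closedin Y (topspace Y \<inter> F2)"
    "\<And>x. x \<in> topspace X \<Longrightarrow> r x \<in> F1 \<longleftrightarrow> x \<in> F1" "\<And>x. x \<in> topspace X \<Longrightarrow> r x \<in> F2 \<longleftrightarrow> x \<in> F2"
proof -
  define p where "p = (\<lambda>x. (x \<in> F1, x \<in> F2))"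
  \<comment> \<open>The choice depends on \<open>x\<close> only through \<open>p x\<close>, so all
    points of one class share their representative.\<close>
  define r where "r = (\<lambda>x. SOME z. z \<in> topspace X \<and> p z = p x)"
  have r: "r x \<in> topspace X \<and> p (r x) = p x" if "x \<in> topspace X" for x
    unfolding r_def by (rule someI[of _ x]) (simp add: that)
  then have r1: "r x \<in> F1 \<longleftrightarrow> x \<in> F1" and r2: "r x \<in> F2 \<longleftrightarrow> x \<in> F2"
    if "x \<in> topspace X" for x
    using that by (auto simp: p_def)
  \<comment> \<open>The quotient topology along \<open>r\<close>, on the set of
    representatives.\<close>
  define T where "T = (\<lambda>U. U \<subseteq> r ` topspace X \<and> openin X {x \<in> topspace X. r x \<in> U})"
  have "istopology T"
    unfolding istopology_def
  proof (intro conjI allI impI)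
    fix S S' assume "T S" "T S'"
    moreover have "{x \<in> topspace X. r x \<in> S \<inter> S'} =
        {x \<in> topspace X. r x \<in> S} \<inter> {x \<in> topspace X. r x \<in> S'}" by blast
    ultimately show "T (S \<inter> S')" unfolding T_def by auto
  next
    fix \<K> assume "\<forall>S\<in>\<K>. T S"
    moreover have "{x \<in> topspace X. r x \<in> \<Union>\<K>} = (\<Union>S\<in>\<K>. {x \<in> topspace X. r x \<in> S})"
      by blast
    ultimately show "T (\<Union>\<K>)" unfolding T_def by auto
  qed
  define Y where "Y = topology T"
  have op: "openin Y = T"
    unfolding Y_def using \<open>istopology T\<close> by (rule topology_inverse')
  have "{x \<in> topspace X. r x \<in> r ` topspace X} = topspace X"
    by blast
  then have "T (r ` topspace X)"
    by (simp add: T_def)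
  then have "r ` topspace X \<subseteq> topspace Y"
    by (simp add: openin_subset op)
  moreover have "T (topspace Y)"
    using openin_topspace[of Y] by (simp only: op)
  then have "topspace Y \<subseteq> r ` topspace X"
    by (simp add: T_def)
  ultimately have top: "topspace Y = r ` topspace X"
    by (rule subset_antisym[rotated])
  have cl: "T (r ` topspace X - F)"
    if "closedin X F" "\<And>x. x \<in> topspace X \<Longrightarrow> r x \<in> F \<longleftrightarrow> x \<in> F" for F
  proof -
    have "{x \<in> topspace X. r x \<in> r ` topspace X - F} = topspace X - F"
      using that(2) by blast
    then show ?thesis using that(1) by (auto simp: T_def)
  qed
  show thesis
  proof
    show "topspace Y \<subseteq> topspace X"
      using r by (auto simp: top)
    \<comment> \<open>\<open>r\<close> factors through \<open>p\<close>, whose values lie in a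
      four-element type; hence its image is finite.\<close>
    have "r x = (\<lambda>q. SOME z. z \<in> topspace X \<and> p z = q) (p x)" for x
      by (simp add: r_def)
    then have "r ` topspace X \<subseteq> range (\<lambda>q. SOME z. z \<in> topspace X \<and> p z = q)"
      by blast
    then show "finite (topspace Y)"
      unfolding top by (rule finite_subset) simp
    show "t0_space Y"
      unfolding t0_space_def top op
    proof (intro ballI impI)
      fix a b assume a: "a \<in> r ` topspace X" and b: "b \<in> r ` topspace X" and "a \<noteq> b"
      then obtain x y where xy: "a = r x" "b = r y" "x \<in> topspace X" "y \<in> topspace X"
        by blast
      then have "p x \<noteq> p y"
        using \<open>a \<noteq> b\<close> by (auto simp: r_def)
      then have "(a \<in> F1) \<noteq> (b \<in> F1) \<or> (a \<in> F2) \<noteq> (b \<in> F2)"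
        using xy r1 r2 by (auto simp: p_def)
      \<comment> \<open>The complement, within the carrier, of whichever of \<open>F1\<close> and
        \<open>F2\<close> contains just one of \<open>a\<close> and \<open>b\<close> is open and
        separates them.\<close>
      then show "\<exists>U. T U \<and> (a \<notin> U) = (b \<in> U)"
        using a b cl[OF F1 r1] cl[OF F2 r2] by (metis DiffI Diff_iff)
    qed
    show "continuous_map X Y r"
      unfolding continuous_map_def top op by (auto simp: T_def)
    show "closedin Y (topspace Y \<inter> F1)"
      using cl[OF F1 r1] by (auto simp: closedin_def top op Diff_Int)
    show "closedin Y (topspace Y \<inter> F2)"
      using cl[OF F2 r2] by (auto simp: closedin_def top op Diff_Int)
  qed (use r1 r2 in auto)
qed

text \<open>A carrier must be the extension of an element of the universe; closure under subsets
  provides this for carriers inside \<open>topspace X\<close>.\<close>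

lemma finite_t0_in_Sob:
  assumes "set_universe elts" "X \<in> Top0 elts"
    "topspace Y \<subseteq> topspace X" "finite (topspace Y)" "t0_space Y"
  shows "Y \<in> Sob elts"
proof -
  have "\<exists>b. elts b = topspace Y"
    using assms(1-3) unfolding set_universe_def Top0_def mem_Collect_eq by metis
  then show ?thesis
    using assms sober_space_finite_t0 by (auto simp: Sob_def Top0_def)
qed

section \<open>Irreducibility of K-sets\<close>

text \<open>The empty set has empty closure, which no point closure equals. The map \<open>f\<close>
  supplies an instance of the condition in \<open>K_set\<close>, which could otherwise hold
  vacuously.\<close>

lemma K_set_nonempty:
  assumes "Y \<in> K" "continuous_map X Y f" "K_set K X A"
  shows "A \<noteq> {}"
proof
  assume "A = {}"
  then obtain y where y: "y \<in> topspace Y" "Y closure_of {} = Y closure_of {y}"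
    using assms unfolding K_set_def by (metis image_empty)
  have "y \<in> Y closure_of {y}"
    using y(1) by (simp add: in_closure_of)
  then show False using y(2) by (metis closure_of_empty empty_iff)
qed

text \<open>Given a closed cover of \<open>A\<close> by \<open>F1\<close> and \<open>F2\<close>,
  pass to the finite quotient. There the image of \<open>A\<close> has the closure of a single
  point, which lies in one of the two closed traces; \<open>r\<close> reflects membership back to
  \<open>X\<close>.\<close>

lemma K_set_imp_irreducible_in:
  assumes univ: "set_universe elts" and Sob: "Sob elts \<subseteq> K"
    and X: "X \<in> Top0 elts" and A: "K_set K X A"
  shows "irreducible_in X A"
proof -
  have sub: "A \<subseteq> topspace X"
    using A by (simp add: K_set_def)
  have "A \<subseteq> F1 \<or> A \<subseteq> F2"
    if F: "closedin X F1" "closedin X F2" and cover: "A \<subseteq> F1 \<union> F2" for F1 F2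
  proof -
    obtain Y r where Y: "topspace Y \<subseteq> topspace X" "finite (topspace Y)" "t0_space Y"
      and r: "continuous_map X Y r"
      and cl: "closedin Y (topspace Y \<inter> F1)" "closedin Y (topspace Y \<inter> F2)"
      and mem: "\<And>x. x \<in> topspace X \<Longrightarrow> r x \<in> F1 \<longleftrightarrow> x \<in> F1"
        "\<And>x. x \<in> topspace X \<Longrightarrow> r x \<in> F2 \<longleftrightarrow> x \<in> F2"
      by (rule finite_t0_quotient[OF F]) blast
    have "Y \<in> K"
      using finite_t0_in_Sob[OF univ X Y] Sob by blast
    then obtain y where y: "y \<in> topspace Y" "Y closure_of (r ` A) = Y closure_of {y}"
      using A r unfolding K_set_def by blast
    have rA: "r ` A \<subseteq> topspace Y"
      using r sub continuous_map_image_subset_topspace by blast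
    have "r ` A \<subseteq> topspace Y \<inter> F1 \<union> topspace Y \<inter> F2"
      using rA cover mem sub by blast
    then have "Y closure_of {y} \<subseteq> topspace Y \<inter> F1 \<union> topspace Y \<inter> F2"
      unfolding y(2)[symmetric] by (rule closure_of_minimal) (intro closedin_Un cl)
    moreover have "y \<in> Y closure_of {y}"
      using y(1) by (simp add: in_closure_of)
    ultimately have "{y} \<subseteq> topspace Y \<inter> F1 \<or> {y} \<subseteq> topspace Y \<inter> F2"
      by blast
    then have "Y closure_of {y} \<subseteq> F1 \<or> Y closure_of {y} \<subseteq> F2"
      using cl by (meson closure_of_minimal le_inf_iff)
    then have "r ` A \<subseteq> F1 \<or> r ` A \<subseteq> F2"
      using closure_of_subset[OF rA] y(2) by auto
    then show ?thesis using mem sub by blast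
  qed
  moreover have "A \<noteq> {}"
  proof -
    \<comment> \<open>With both closed sets empty, the quotient just supplies a continuous map from
      \<open>X\<close> into a member of \<open>K\<close>.\<close>
    obtain Y r where "topspace Y \<subseteq> topspace X" "finite (topspace Y)" "t0_space Y"
      "continuous_map X Y r"
      by (rule finite_t0_quotient[OF closedin_empty closedin_empty, of X]) blast
    then show ?thesis
      using finite_t0_in_Sob[OF univ X] Sob K_set_nonempty[OF _ _ A] by blast
  qed
  ultimately show ?thesis
    using sub by (auto simp: irreducible_in_def)
qed

section \<open>The lower Vietoris topology on closed K-sets\<close>

lemma topspace_P_H: "topspace (P_H elts K X) = closed_K_sets elts K X"
  by (simp add: P_H_def)

text \<open>Diamonds always commute with unions, and by irreducibility also with binary
  intersections, so the subbase is already a topology.\<close>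

lemma openin_P_H:
  assumes irr: "\<And>a. a \<in> closed_K_sets elts K X \<Longrightarrow> irreducible_in X (elts a)"
  shows "openin (P_H elts K X) W \<longleftrightarrow> (\<exists>U. openin X U \<and> W = diamond elts K X U)"
proof
  define T where "T = (\<lambda>W. \<exists>U. openin X U \<and> W = diamond elts K X U)"
  have "istopology T"
    unfolding istopology_def
  proof (intro conjI allI impI)
    fix S S' assume "T S" "T S'"
    then obtain U V where UV: "openin X U" "openin X V"
        "S = diamond elts K X U" "S' = diamond elts K X V"
      unfolding T_def by blast
    have "S \<inter> S' = diamond elts K X (U \<inter> V)"
      using irreducible_in_meets_Int[OF irr UV(1,2)] unfolding UV(3,4) diamond_def by blast
    then show "T (S \<inter> S')"
      unfolding T_def using UV(1,2) by blast
  next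
    fix \<K> assume "\<forall>S\<in>\<K>. T S"
    then obtain u where u: "\<And>S. S \<in> \<K> \<Longrightarrow> openin X (u S) \<and> S = diamond elts K X (u S)"
      unfolding T_def by metis
    have "(\<Union>S\<in>\<K>. diamond elts K X (u S)) = diamond elts K X (\<Union>S\<in>\<K>. u S)"
      unfolding diamond_def by blast
    moreover have "\<Union>\<K> = (\<Union>S\<in>\<K>. diamond elts K X (u S))"
      using u by auto
    moreover have "openin X (\<Union>S\<in>\<K>. u S)"
      using u by blast
    ultimately show "T (\<Union>\<K>)"
      unfolding T_def by metis
  qed
  then have op: "openin (topology T) = T"
    by (rule topology_inverse')
  \<comment> \<open>Irreducible sets are nonempty, so every member of
    \<open>closed_K_sets elts K X\<close> meets the whole space.\<close>
  have "closed_K_sets elts K X = diamond elts K X (topspace X)"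
    using irr by (fastforce simp: diamond_def irreducible_in_def)
  then have "T (closed_K_sets elts K X)"
    unfolding T_def by blast
  then have "openin (topology T) (closed_K_sets elts K X)"
    by (simp add: op)
  moreover assume "openin (P_H elts K X) W"
  moreover have "openin (topology T) S" if "\<exists>U. openin X U \<and> S = diamond elts K X U" for S
    using that by (simp add: op) (simp add: T_def)
  \<comment> \<open>The topology generated by a subbase is the smallest one that contains it and has
    the carrier open.\<close>
  ultimately have "openin (topology T) W"
    unfolding P_H_def by (rule minimal_topology_subbase[rotated])
  then have "T W"
    by (simp add: op)
  then show "\<exists>U. openin X U \<and> W = diamond elts K X U"
    unfolding T_def .
next
  assume "\<exists>U. openin X U \<and> W = diamond elts K X U"
  then have "(finite intersection_of (\<lambda>S. \<exists>U. openin X U \<and> S = diamond elts K X U)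
      relative_to closed_K_sets elts K X) (closed_K_sets elts K X \<inter> W)"
    by (intro relative_to_inc finite_intersection_of_inc)
  moreover have "closed_K_sets elts K X \<inter> W = W"
    using \<open>\<exists>U. _\<close> by (auto simp: diamond_def)
  ultimately show "openin (P_H elts K X) W"
    unfolding P_H_def openin_subbase by (simp add: arbitrary_union_of_inc)
qed

section \<open>Point closures and the comparison of closures\<close>

text \<open>By continuity the point \<open>f x\<close> serves as \<open>y\<close>, and T0 makes it
  unique. Hence the unit \<open>\<eta>\<close> lands in K(X).\<close>

lemma closure_of_sing_K_set:
  assumes "x \<in> topspace X" and t0: "\<And>Y. Y \<in> K \<Longrightarrow> t0_space Y"
  shows "K_set K X (X closure_of {x})"
  unfolding K_set_def
proof (intro conjI ballI allI impI)
  fix Y f assume Y: "Y \<in> K" and f: "continuous_map X Y f"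
  have fx: "f x \<in> topspace Y"
    using f assms(1) by (auto simp: continuous_map_def)
  have "f ` (X closure_of {x}) \<subseteq> Y closure_of {f x}"
    using continuous_map_image_closure_subset[OF f, of "{x}"] by simp
  then have "Y closure_of (f ` (X closure_of {x})) \<subseteq> Y closure_of {f x}"
    by (simp add: closure_of_minimal)
  moreover have "x \<in> X closure_of {x}"
    using assms(1) by (simp add: in_closure_of)
  then have "Y closure_of {f x} \<subseteq> Y closure_of (f ` (X closure_of {x}))"
    by (intro closure_of_mono) simp
  ultimately have "Y closure_of (f ` (X closure_of {x})) = Y closure_of {f x}"
    by blast
  then show "\<exists>!y. y \<in> topspace Y \<and> Y closure_of (f ` (X closure_of {x})) = Y closure_of {y}"
    using fx t0_space_closure_of_sing_inject[OF t0[OF Y]] by metis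
qed (rule closure_of_subset_topspace)

lemma closure_of_eqI:
  assumes "\<And>U. openin X U \<Longrightarrow> S \<inter> U \<noteq> {} \<longleftrightarrow> S' \<inter> U \<noteq> {}"
  shows "X closure_of S = X closure_of S'"
proof -
  have "(\<exists>y. y \<in> S \<and> y \<in> U) \<longleftrightarrow> (\<exists>y. y \<in> S' \<and> y \<in> U)" if "openin X U" for U
    using assms[OF that] by blast
  then show ?thesis
    unfolding set_eq_iff in_closure_of by metis
qed

lemma openin_meets_closure_of_iff:
  assumes "openin X U"
  shows "X closure_of S \<inter> U \<noteq> {} \<longleftrightarrow> S \<inter> U \<noteq> {}"
  using openin_Int_closure_of_eq_empty[OF assms, of S] by (simp add: Int_commute)

lemma openin_closure_of_sing_mem_iff:
  assumes "openin X U" "X closure_of S = X closure_of {x}"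
  shows "x \<in> U \<longleftrightarrow> S \<inter> U \<noteq> {}"
  using openin_meets_closure_of_iff[OF assms(1), of S]
    openin_meets_closure_of_iff[OF assms(1), of "{x}"] assms(2) by auto

section \<open>The universal property\<close>

lemma is_reflection_P_H:
  assumes univ: "set_universe elts" and Top0: "K \<subseteq> Top0 elts" and Sob: "Sob elts \<subseteq> K"
    and X: "X \<in> Top0 elts" and PH: "P_H elts K X \<in> K"
  shows "is_reflection K X (P_H elts K X) (\<lambda>x. inv elts (X closure_of {x}))"
proof -
  define R where "R = P_H elts K X"
  define \<eta> where "\<eta> = (\<lambda>x. inv elts (X closure_of {x}))"
  have t0: "t0_space Y" if "Y \<in> K" for Y
    using that Top0 by (auto simp: Top0_def)
  have topR: "topspace R = closed_K_sets elts K X"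
    by (simp add: R_def topspace_P_H)
  have opR: "openin R W \<longleftrightarrow> (\<exists>U. openin X U \<and> W = diamond elts K X U)" for W
    unfolding R_def
    by (rule openin_P_H, rule K_set_imp_irreducible_in[OF univ Sob X])
       (simp add: closed_K_sets_def)
  \<comment> \<open>\<open>inv elts\<close> is meaningful only on the range of \<open>elts\<close>;
    subsets of \<open>topspace X\<close> lie in that range.\<close>
  have elts_\<eta>: "elts (\<eta> x) = X closure_of {x}" for x
  proof -
    obtain s where "elts s = topspace X"
      using X by (auto simp: Top0_def)
    then have "X closure_of {x} \<in> range elts"
      using univ closure_of_subset_topspace[of X "{x}"] unfolding set_universe_def by (metis rangeI)
    then show ?thesis
      by (simp add: \<eta>_def f_inv_into_f)
  qed
  have \<eta>_top: "\<eta> x \<in> topspace R" if "x \<in> topspace X" for x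
    using closure_of_sing_K_set[OF that t0] by (simp add: topR closed_K_sets_def elts_\<eta>)
  \<comment> \<open>An open set meets the closure of \<open>{x}\<close> exactly when it contains
    \<open>x\<close>, so \<open>\<eta>\<close> pulls the diamond of \<open>U\<close> back to
    \<open>U\<close>.\<close>
  have \<eta>_diamond: "\<eta> x \<in> diamond elts K X U \<longleftrightarrow> x \<in> U" if "openin X U" "x \<in> topspace X" for x U
    using \<eta>_top[OF that(2)] openin_meets_closure_of_iff[OF that(1), of "{x}"]
    by (simp add: diamond_def topR elts_\<eta>)
  have \<eta>: "continuous_map X R \<eta>"
    unfolding continuous_map_def
  proof (intro conjI allI impI)
    fix W assume "openin R W"
    then obtain U where U: "openin X U" "W = diamond elts K X U"
      using opR by blast
    then have "{x \<in> topspace X. \<eta> x \<in> W} = U"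
      using \<eta>_diamond openin_subset by blast
    then show "openin X {x \<in> topspace X. \<eta> x \<in> W}" using U by simp
  qed (use \<eta>_top in auto)
  have closure_\<eta>: "R closure_of (\<eta> ` elts a) = R closure_of {a}" if a: "a \<in> topspace R" for a
  proof -
    have sub: "elts a \<subseteq> topspace X"
      using a by (auto simp: topR closed_K_sets_def K_set_def)
    show ?thesis
    proof (rule closure_of_eqI)
      fix W assume "openin R W"
      then obtain U where U: "openin X U" "W = diamond elts K X U"
        using opR[of W] by blast
      have "\<eta> ` elts a \<inter> W \<noteq> {} \<longleftrightarrow> elts a \<inter> U \<noteq> {}"
        using sub \<eta>_diamond[OF U(1)] unfolding U(2) by blast
      also have "\<dots> \<longleftrightarrow> a \<in> W"
        using a by (simp add: U(2) diamond_def topR)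
      finally show "\<eta> ` elts a \<inter> W \<noteq> {} \<longleftrightarrow> {a} \<inter> W \<noteq> {}" by simp
    qed
  qed
  have "\<exists>!g. g \<in> extensional (topspace R) \<and> continuous_map R Y g \<and>
      (\<forall>x\<in>topspace X. g (\<eta> x) = f x)"
    if Y: "Y \<in> K" and f: "continuous_map X Y f" for Y f
  proof -
    have "\<exists>y. y \<in> topspace Y \<and> Y closure_of (f ` elts a) = Y closure_of {y}"
      if "a \<in> topspace R" for a
      using that Y f unfolding topR closed_K_sets_def K_set_def by blast
    then obtain g0 where g0: "\<And>a. a \<in> topspace R \<Longrightarrow>
        g0 a \<in> topspace Y \<and> Y closure_of (f ` elts a) = Y closure_of {g0 a}"
      by metis
    \<comment> \<open>Restricting makes \<open>g\<close> extensional, as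
      \<open>is_reflection\<close> demands.\<close>
    define g where "g = restrict g0 (topspace R)"
    have g_top: "g a \<in> topspace Y" and g_closure: "Y closure_of (f ` elts a) = Y closure_of {g a}"
      if "a \<in> topspace R" for a
      using g0[OF that] that by (simp_all add: g_def)
    have g_cont: "continuous_map R Y g"
      unfolding continuous_map_def
    proof (intro conjI allI impI)
      fix V assume V: "openin Y V"
      \<comment> \<open>The preimage of \<open>V\<close> under \<open>g\<close> is thus the diamond
        of its preimage under \<open>f\<close>, which gives continuity.\<close>
      have "g a \<in> V \<longleftrightarrow> elts a \<inter> {x \<in> topspace X. f x \<in> V} \<noteq> {}" if a: "a \<in> topspace R" for a
      proof -
        have "elts a \<subseteq> topspace X"
          using a by (auto simp: topR closed_K_sets_def K_set_def)
        then show ?thesis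
          using openin_closure_of_sing_mem_iff[OF V g_closure[OF a]] by blast
      qed
      then have "{a \<in> topspace R. g a \<in> V} = diamond elts K X {x \<in> topspace X. f x \<in> V}"
        unfolding diamond_def topR[symmetric] by blast
      then show "openin R {a \<in> topspace R. g a \<in> V}"
        using openin_continuous_map_preimage[OF f V] by (subst opR) blast
    qed (use g_top in auto)
    have unique: "h a = g a"
      if h: "continuous_map R Y h" "\<And>x. x \<in> topspace X \<Longrightarrow> h (\<eta> x) = f x"
        and a: "a \<in> topspace R" for h a
    proof (rule t0_space_closure_of_sing_inject[OF t0[OF Y]])
      show ha: "h a \<in> topspace Y"
        using h(1) a by (auto simp: continuous_map_def)
      show "g a \<in> topspace Y" by (rule g_top[OF a])
      have sub: "elts a \<subseteq> topspace X"
        using a by (auto simp: topR closed_K_sets_def K_set_def)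
      then have hf: "h ` \<eta> ` elts a = f ` elts a"
        using h(2) by (force simp: image_image)
      \<comment> \<open>The open preimage of \<open>V\<close> under \<open>h\<close> contains
        \<open>a\<close> iff it meets the image of \<open>elts a\<close> under
        \<open>\<eta>\<close>, by \<open>closure_\<eta>\<close>; composing \<open>h\<close> with
        \<open>\<eta>\<close> gives \<open>f\<close>.\<close>
      have "h a \<in> V \<longleftrightarrow> f ` elts a \<inter> V \<noteq> {}" if V: "openin Y V" for V
      proof -
        have "h a \<in> V \<longleftrightarrow> a \<in> {b \<in> topspace R. h b \<in> V}"
          using a by simp
        also have "\<dots> \<longleftrightarrow> \<eta> ` elts a \<inter> {b \<in> topspace R. h b \<in> V} \<noteq> {}"
          by (rule openin_closure_of_sing_mem_iff[OF
                openin_continuous_map_preimage[OF h(1) V] closure_\<eta>[OF a]])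
        also have "\<dots> \<longleftrightarrow> f ` elts a \<inter> V \<noteq> {}"
          unfolding hf[symmetric] using sub \<eta>_top by blast
        finally show ?thesis .
      qed
      then have "Y closure_of {h a} = Y closure_of (f ` elts a)"
        by (intro closure_of_eqI) auto
      then show "Y closure_of {h a} = Y closure_of {g a}"
        using g_closure[OF a] by simp
    qed
    have "g (\<eta> x) = f x" if x: "x \<in> topspace X" for x
    proof (rule t0_space_closure_of_sing_inject[OF t0[OF Y]])
      show fx: "f x \<in> topspace Y"
        using f x by (auto simp: continuous_map_def)
      show "g (\<eta> x) \<in> topspace Y"
        by (rule g_top[OF \<eta>_top[OF x]])
      \<comment> \<open>Here \<open>elts (\<eta> x)\<close> is the closure of \<open>{x}\<close>,
        which meets the open preimage of \<open>V\<close> under \<open>f\<close> iff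
        \<open>x\<close> lies in it.\<close>
      have "g (\<eta> x) \<in> V \<longleftrightarrow> f x \<in> V" if V: "openin Y V" for V
      proof -
        have "g (\<eta> x) \<in> V \<longleftrightarrow> f ` (X closure_of {x}) \<inter> V \<noteq> {}"
          using openin_closure_of_sing_mem_iff[OF V g_closure[OF \<eta>_top[OF x]]]
          by (simp add: elts_\<eta>)
        also have "\<dots> \<longleftrightarrow> X closure_of {x} \<inter> {x \<in> topspace X. f x \<in> V} \<noteq> {}"
          using closure_of_subset_topspace[of X "{x}"] by blast
        also have "\<dots> \<longleftrightarrow> f x \<in> V"
          using openin_meets_closure_of_iff[OF openin_continuous_map_preimage[OF f V], of "{x}"] x
          by simp
        finally show ?thesis .
      qed
      then show "Y closure_of {g (\<eta> x)} = Y closure_of {f x}"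
        by (intro closure_of_eqI) auto
    qed
    then show ?thesis
      using g_cont unique
      by (intro ex1I[of _ g]) (auto simp: g_def intro: extensionalityI)
  qed
  then show ?thesis
    using PH \<eta> unfolding is_reflection_def R_def \<eta>_def by blast
qed

theorem corollary4p8:
  fixes elts :: "'u \<Rightarrow> 'u set"
    and K :: "'u topology set"
  assumes "set_universe elts"
    and "K \<subseteq> Top0 elts"
    and "Sob elts \<subseteq> K"
    and "adequate elts K"
  shows "reflective_in K (Top0 elts)"
  unfolding reflective_in_def
  using is_reflection_P_H[OF assms(1-3)] assms(2,4) unfolding adequate_def by blast

end
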